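(* Let $d\ge1$ be a fixed integer, $\epsilon>0$ fixed, and let $\ell=\lceil\log(n)+(d-1+\epsilon)\log(\log(n))\rceil$ and $L=2\ell$. Then for all $n$ large enough, on every input $\mathbf{w}\in\{0,1\}^{n-1}$ the encoding algorithm $\mathrm{LDEncode}(\mathbf{w},L,d)$ described in the context successfully returns (whatever choices it makes) a string from $\mathcal{Z}_n(L,d)$, i.e. a length-$n$ binary string that is $(L,d)$-substring distant.
   Context: All logarithms are base 2; $\Sigma=\{0,1\}$; $[i]=\{1,\dots,i\}$; $\circ$ is concatenation; $|\mathbf{x}|$ is the length of $\mathbf{x}$; $\mathbf{x}_{i,k}=(x_i,\dots,x_{i+k-1})$; $\mathrm{Pref}_k$ is the length-$k$ prefix; $d_H$ is Hamming distance. $\mathbf{x}\in\Sigma^n$ is $(L,d)$-substring distant if $d_H(\mathbf{x}_{i,L},\mathbf{x}_{j,L})\ge d$ for all $1\le i<j\le n-L+1$; $\mathcal{Z}_n(L,d)$ is the set of all such strings. $\mathcal{B}_r(\mathbf{v})=\{\mathbf{y}\in\Sigma^{|\mathbf{v}|}: d_H(\mathbf{v},\mathbf{y})\le r\}$. For a finite set $I$ of integers and $a\in I$, $b_I(a)$ is the binary representation of the index of $a$ in $I$ (increasing order), using $\lceil\log|I|\rceil$ bits; $b=b_{[n]}$. For $\mathbf{v},\mathbf{v}'\in\Sigma^N$ with $d_H(\mathbf{v},\mathbf{v}')\le\rho$ and differing positions $p_1,p_2,\dots$, $EncDist_{N,\rho}(\mathbf{v},\mathbf{v}')=\mathbf{y}_1\circ\cdots\circ\mathbf{y}_\rho$,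 where $\mathbf{y}_i=b_{[N]}(p_i)$ if $i\le d_H(\mathbf{v},\mathbf{v}')$ and $\mathbf{y}_i$ is the all-zero string of length $\lceil\log N\rceil$ otherwise; its length is $\rho\lceil\log N\rceil$. $\mathbf{u}_d$ is a fixed $d$-auto cyclic string of length $d\lceil\log d\rceil+2d$ (known to exist): a string $\mathbf{u}$ of length $N$ is $d$-auto cyclic if $d_H(\mathbf{u},0^i\circ\mathbf{u}_{1,N-i})\ge d$ for every $1\le i\le d$. For $\mathbf{v}\in\Sigma^k$ with $k\le N$ and $m=\lceil N/k\rceil$, the concatenation ball $\mathcal{CB}_{N,r}(\mathbf{v})$ is the set of all strings $\mathrm{Pref}_N(\mathbf{v}_1\circ\cdots\circ\mathbf{v}_m)$ for which there are nonnegative integers $r_1,\dots,r_m$ with $\sum_i r_i\le r$, such that with $\mathbf{v}_0=\mathbf{v}$ we have $\mathbf{v}_i\in\mathcal{B}_{r_i}(\mathbf{v}_{i-1})$ for all $i\in[m]$. Algorithm $\mathrm{LDEncode}(\mathbf{w},L,d)$, for $\mathbf{w}\in\Sigma^{n-1}$: Initialization: $\mathbf{x}=\mathbf{w}\circ 0\circ 1^d\circ 0^{\ell-|\mathbf{u}_d|}\circ\mathbf{u}_d$. (The last $\ell+d+1$ symbols are called the marker.) Elimination: while there exist indices $i<j$ with $d_H(\mathbf{x}_{i,L},\mathbf{x}_{j,L})<d$, or an index $i\le|\mathbf{x}|-2\ell+|\mathbf{u}_d|$ with $d_H(\mathbf{x}_{i,\ell},0^{\ell-|\mathbf{u}_d|}\circ\mathbf{u}_d)<d$,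 do one of the following for such a violation (all strings on the right refer to $\mathbf{x}$ before the modification). Case 1 (violating $\mathbf{x}_{i,L},\mathbf{x}_{j,L}$, $i<j$). Let $J_1=\{|\mathbf{x}|-L-\ell-d,\dots,|\mathbf{x}|-L+1\}$. If $i,j\in J_1$: remove from $\mathbf{x}$ the part of the window $\mathbf{x}_{i,L}$ preceding the marker, i.e. $\mathbf{x}_{i,|\mathbf{x}|-\ell-d-i}$, and append $100\circ b_{J_1}(i)\circ b_{J_1}(j)\circ EncDist_{L,d-1}(\mathbf{x}_{i,L},\mathbf{x}_{j,L})$ to the left of $\mathbf{x}$. Otherwise: remove $\mathbf{x}_{i,L}$ and append $101\circ b(i)\circ b(j)\circ EncDist_{L,d-1}(\mathbf{x}_{i,L},\mathbf{x}_{j,L})$ to the left. Case 2 (violating $\mathbf{x}_{i,\ell}$). Let $J_2=\{|\mathbf{x}|-2\ell-d,\dots,|\mathbf{x}|-2\ell+|\mathbf{u}_d|\}$. If $i\in J_2$: remove the part of $\mathbf{x}_{i,\ell}$ preceding the marker, i.e. $\mathbf{x}_{i,|\mathbf{x}|-\ell-d-i}$, and append $11\circ b_{J_2}(i)\circ EncDist_{\ell,d-1}(\mathbf{x}_{i,\ell},0^{\ell-|\mathbf{u}_d|}\circ\mathbf{u}_d)$ to the left. Otherwise: remove $\mathbf{x}_{i,\ell}$ and append $0\circ b(i)\circ EncDist_{\ell,d-1}(\mathbf{x}_{i,\ell},0^{\ell-|\mathbf{u}_d|}\circ\mathbf{u}_d)$ to the left. After elimination: if $|\mathbf{x}|\ge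 n$, return $\mathbf{x}_{1,n}$. Expansion: while $|\mathbf{x}|<n$: set $$B=\Big(\bigcup_{i=1}^{|\mathbf{x}|-\ell}\mathcal{B}_{d-1}(\mathbf{x}_{i,\ell})\Big)\cup\Big(\bigcup_{i=|\mathbf{x}|-\ell+1}^{|\mathbf{x}|}\mathcal{CB}_{\ell,d-1}(\mathbf{x}_{i,|\mathbf{x}|-i+1})\Big),$$ pick any $\mathbf{y}\in\Sigma^\ell\setminus B$, and replace $\mathbf{x}$ by $\mathbf{x}\circ\mathbf{y}$. Finally return $\mathbf{x}_{1,n}$. "Successfully returns" means that the algorithm terminates, every required choice exists, and the returned string has length $n$. *)

theory Defs
  imports Complex_Main
begin

text \<open>
  Binary strings are \<^typ>\<open>bool list\<close>s, with \<^const>\<open>False\<close> for the symbol 0 and \<^const>\<open>True\<close> for 1.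
  Positions in strings are counted from 1 throughout.
\<close>

definition substring :: "'a list \<Rightarrow> nat \<Rightarrow> nat \<Rightarrow> 'a list" where
  "substring x i k = take k (drop (i - 1) x)"

definition remove_substring :: "'a list \<Rightarrow> nat \<Rightarrow> nat \<Rightarrow> 'a list" where
  "remove_substring x i k = take (i - 1) x @ drop (i - 1 + k) x"

text \<open>Intended for strings of equal length.\<close>

definition hamming :: "'a list \<Rightarrow> 'a list \<Rightarrow> nat" where
  "hamming x y = card {p. p < length x \<and> x ! p \<noteq> y ! p}"

definition hamming_ball :: "nat \<Rightarrow> bool list \<Rightarrow> bool list set" where
  "hamming_ball r v = {y. length y = length v \<and> hamming v y \<le> r}"

definition substring_distant :: "nat \<Rightarrow> nat \<Rightarrow> bool list \<Rightarrow> bool" where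
  "substring_distant L d x \<longleftrightarrow>
     (\<forall>i j. 1 \<le> i \<and> i < j \<and> j \<le> length x - L + 1 \<longrightarrow>
        hamming (substring x i L) (substring x j L) \<ge> d)"

definition distant_strings :: "nat \<Rightarrow> nat \<Rightarrow> nat \<Rightarrow> bool list set" where
  "distant_strings n L d = {x. length x = n \<and> substring_distant L d x}"

definition auto_cyclic :: "nat \<Rightarrow> bool list \<Rightarrow> bool" where
  "auto_cyclic d u \<longleftrightarrow>
     (\<forall>i\<in>{1..d}. hamming u (replicate i False @ take (length u - i) u) \<ge> d)"

definition ceil_log :: "nat \<Rightarrow> nat" where
  "ceil_log N = nat \<lceil>log 2 (real N)\<rceil>"

text \<open>
  The elements of \<open>I\<close> are numbered from 0 in increasing order, so that every number fits into
  \<open>ceil_log (card I)\<close> bits. The most significant bit comes first. Index sets consist of integers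
  since the lower end of an index interval may be negative when the current string is short.
\<close>

definition index_code :: "int set \<Rightarrow> int \<Rightarrow> bool list" where
  "index_code I a = rev (map (bit (card {c \<in> I. c < a})) [0..<ceil_log (card I)])"

definition differing_positions :: "'a list \<Rightarrow> 'a list \<Rightarrow> nat list" where
  "differing_positions v v' = filter (\<lambda>p. v ! (p - 1) \<noteq> v' ! (p - 1)) [1..<length v + 1]"

definition enc_dist :: "nat \<Rightarrow> nat \<Rightarrow> bool list \<Rightarrow> bool list \<Rightarrow> bool list" where
  "enc_dist N \<rho> v v' =
     concat (map (\<lambda>i. if i \<le> hamming v v'
                       then index_code {1..int N} (int (differing_positions v v' ! (i - 1)))
                       else replicate (ceil_log N) False) [1..<\<rho> + 1])"

definition concat_ball :: "nat \<Rightarrow> nat \<Rightarrow> bool list \<Rightarrow> bool list set" where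
  "concat_ball N r v =
     (let m = nat \<lceil>real N / real (length v)\<rceil> in
       {take N (concat (map vs [1..<m + 1])) | (vs :: nat \<Rightarrow> bool list) (rs :: nat \<Rightarrow> nat).
          vs 0 = v \<and> (\<Sum>i = 1..m. rs i) \<le> r \<and>
          (\<forall>i\<in>{1..m}. vs i \<in> hamming_ball (rs i) (vs (i - 1)))})"


text \<open>
  The encoder is a nondeterministic transition system; each transition makes one choice. In all
  definitions below \<open>n\<close> is the target length, \<open>l\<close> the block length, \<open>L\<close> the window length and
  \<open>u\<close> the auto-cyclic string at the end of the marker.
\<close>

definition marker_end :: "nat \<Rightarrow> bool list \<Rightarrow> bool list" where
  "marker_end l u = replicate (l - length u) False @ u"

definition initial_string :: "nat \<Rightarrow> nat \<Rightarrow> bool list \<Rightarrow> bool list \<Rightarrow> bool list" where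
  "initial_string l d u w = w @ [False] @ replicate d True @ marker_end l u"

definition violating_pair :: "nat \<Rightarrow> nat \<Rightarrow> bool list \<Rightarrow> nat \<Rightarrow> nat \<Rightarrow> bool" where
  "violating_pair L d x i j \<longleftrightarrow>
     1 \<le> i \<and> i < j \<and> j \<le> length x - L + 1 \<and>
     hamming (substring x i L) (substring x j L) < d"

definition violating_index :: "nat \<Rightarrow> nat \<Rightarrow> bool list \<Rightarrow> bool list \<Rightarrow> nat \<Rightarrow> bool" where
  "violating_index l d u x i \<longleftrightarrow>
     1 \<le> i \<and> int i \<le> int (length x) - 2 * int l + int (length u) \<and>
     hamming (substring x i l) (marker_end l u) < d"

definition eliminate_pair ::
    "nat \<Rightarrow> nat \<Rightarrow> nat \<Rightarrow> nat \<Rightarrow> bool list \<Rightarrow> nat \<Rightarrow> nat \<Rightarrow> bool list" where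
  "eliminate_pair n L l d x i j =
     (let J = {int (length x) - int L - int l - int d .. int (length x) - int L + 1};
          e = enc_dist L (d - 1) (substring x i L) (substring x j L)
      in if int i \<in> J \<and> int j \<in> J
         then [True, False, False] @ index_code J (int i) @ index_code J (int j) @ e
                @ remove_substring x i (length x - l - d - i)
         else [True, False, True] @ index_code {1..int n} (int i) @ index_code {1..int n} (int j) @ e
                @ remove_substring x i L)"

definition eliminate_index ::
    "nat \<Rightarrow> nat \<Rightarrow> nat \<Rightarrow> bool list \<Rightarrow> bool list \<Rightarrow> nat \<Rightarrow> bool list" where
  "eliminate_index n l d u x i =
     (let J = {int (length x) - 2 * int l - int d .. int (length x) - 2 * int l + int (length u)};
          e = enc_dist l (d - 1) (substring x i l) (marker_end l u)
      in if int i \<in> J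
         then [True, True] @ index_code J (int i) @ e
                @ remove_substring x i (length x - l - d - i)
         else [False] @ index_code {1..int n} (int i) @ e
                @ remove_substring x i l)"

definition forbidden_blocks :: "nat \<Rightarrow> nat \<Rightarrow> bool list \<Rightarrow> bool list set" where
  "forbidden_blocks l d x =
     (\<Union>i\<in>{1..length x - l}. hamming_ball (d - 1) (substring x i l)) \<union>
     (\<Union>i\<in>{length x - l + 1..length x}. concat_ball l (d - 1) (substring x i (length x - i + 1)))"

datatype ld_state =
    Eliminating "bool list"
  | Expanding "bool list"
  | Returned "bool list"

inductive ld_step ::
    "nat \<Rightarrow> nat \<Rightarrow> nat \<Rightarrow> nat \<Rightarrow> bool list \<Rightarrow> ld_state \<Rightarrow> ld_state \<Rightarrow> bool"
  for n L l d :: nat and u :: "bool list" where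
  elim_pair: "violating_pair L d x i j \<Longrightarrow>
     ld_step n L l d u (Eliminating x) (Eliminating (eliminate_pair n L l d x i j))"
| elim_index: "violating_index l d u x i \<Longrightarrow>
     ld_step n L l d u (Eliminating x) (Eliminating (eliminate_index n l d u x i))"
| elim_done: "(\<nexists>i j. violating_pair L d x i j) \<Longrightarrow> (\<nexists>i. violating_index l d u x i) \<Longrightarrow>
     ld_step n L l d u (Eliminating x)
       (if length x \<ge> n then Returned (take n x) else Expanding x)"
| expand: "length x < n \<Longrightarrow> length y = l \<Longrightarrow> y \<notin> forbidden_blocks l d x \<Longrightarrow>
     ld_step n L l d u (Expanding x) (Expanding (x @ y))"
| expand_done: "length x \<ge> n \<Longrightarrow>
     ld_step n L l d u (Expanding x) (Returned (take n x))"

text \<open>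
  Whatever choices are made: the run is finite, it cannot get stuck before returning, and the
  returned string lies in \<open>Z\<close>.
\<close>

definition ld_encode_returns_in ::
    "nat \<Rightarrow> nat \<Rightarrow> nat \<Rightarrow> nat \<Rightarrow> bool list \<Rightarrow> bool list \<Rightarrow> bool list set \<Rightarrow> bool" where
  "ld_encode_returns_in n L l d u w Z \<longleftrightarrow>
     (let start = Eliminating (initial_string l d u w) in
       (\<nexists>\<sigma> :: nat \<Rightarrow> ld_state. \<sigma> 0 = start \<and> (\<forall>t. ld_step n L l d u (\<sigma> t) (\<sigma> (Suc t)))) \<and>
       (\<forall>s. (ld_step n L l d u)\<^sup>*\<^sup>* start s \<longrightarrow>
          (case s of Returned z \<Rightarrow> z \<in> Z | _ \<Rightarrow> (\<exists>s'. ld_step n L l d u s s'))))"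

end

theory Submission
  imports Defs "HOL-Real_Asymp.Real_Asymp"
begin

text \<open>
  Every elimination step shortens the string and leaves the marker in place, so elimination ends
  with a string without violations. During expansion the last \<open>l\<close> symbols are always at distance at
  least \<open>d\<close> from every earlier window of length \<open>l\<close>: initially because the marker ends in an
  auto-cyclic string preceded by zeros and ones, later by the choice of the new block. As
  \<open>L = 2 * l\<close>, every window of length \<open>L\<close> ending in a new block contains the preceding last block,
  which keeps it away from all earlier windows. A new block exists since for each window the
  forbidden blocks are determined by at most \<open>d - 1\<close> positions, and
  \<open>n * (l + 1) ^ (d - 1) \<le> 2 ^ l\<close> for large \<open>n\<close>.
\<close>

section \<open>Hamming distance of windows\<close>

lemma length_substring: "i - 1 + k \<le> length x \<Longrightarrow> length (substring x i k) = k"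
  by (simp add: substring_def)

lemma nth_substring:
  "i - 1 + k \<le> length x \<Longrightarrow> p < k \<Longrightarrow> substring x i k ! p = x ! (i - 1 + p)"
  by (simp add: substring_def)

lemma substring_append_left: "i - 1 + k \<le> length x \<Longrightarrow> substring (x @ y) i k = substring x i k"
  by (simp add: substring_def)

lemma substring_take: "i - 1 + k \<le> m \<Longrightarrow> substring (take m x) i k = substring x i k"
  by (simp add: substring_def drop_take min_def)

lemma hamming_substring_nth:
  assumes "i - 1 + k \<le> length x" and "j - 1 + k \<le> length y"
  shows "hamming (substring x i k) (substring y j k) =
    card {p. p < k \<and> x ! (i - 1 + p) \<noteq> y ! (j - 1 + p)}"
  unfolding hamming_def using assms
  by (intro arg_cong[of _ _ card]) (auto simp: length_substring nth_substring)

text \<open>Shifting by \<open>h\<close> embeds the mismatches of the inner windows into those of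
  the outer ones. This lets a far-apart pair of blocks keep apart any two windows containing them at
  the same offset.\<close>

lemma hamming_subwindow_le:
  assumes "1 \<le> i" "1 \<le> j" "i - 1 + k \<le> length x" "j - 1 + k \<le> length x" "h + m \<le> k"
  shows "hamming (substring x (i + h) m) (substring x (j + h) m)
    \<le> hamming (substring x i k) (substring x j k)"
proof -
  have "hamming (substring x (i + h) m) (substring x (j + h) m) =
      card {p. p < m \<and> x ! (i + h - 1 + p) \<noteq> x ! (j + h - 1 + p)}"
    using assms by (intro hamming_substring_nth) auto
  also have "\<dots> \<le> card {p. p < k \<and> x ! (i - 1 + p) \<noteq> x ! (j - 1 + p)}"
    using assms by (intro card_inj_on_le[where f = "\<lambda>p. h + p"]) (auto simp: algebra_simps)
  also have "\<dots> = hamming (substring x i k) (substring x j k)"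
    using assms by (intro hamming_substring_nth[symmetric]) auto
  finally show ?thesis .
qed

lemma hamming_append:
  assumes "length a = length b"
  shows "hamming (a @ a') (b @ b') = hamming a b + hamming a' b'"
proof -
  let ?S = "{p. p < length a \<and> a ! p \<noteq> b ! p}"
  let ?T = "{p. p < length a' \<and> a' ! p \<noteq> b' ! p}"
  have "{p. p < length (a @ a') \<and> (a @ a') ! p \<noteq> (b @ b') ! p} = ?S \<union> (\<lambda>p. length a + p) ` ?T"
    (is "?L = ?R")
  proof (intro set_eqI iffI)
    fix p assume p: "p \<in> ?L"
    show "p \<in> ?R"
    proof (cases "p < length a")
      case False
      then have "p = length a + (p - length a)" by simp
      moreover have "p - length a \<in> ?T" using p False assms by (auto simp: nth_append)
      ultimately show ?thesis by blast
    qed (use p assms in \<open>auto simp: nth_append\<close>)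
  qed (use assms in \<open>auto simp: nth_append\<close>)
  moreover have "card (?S \<union> (\<lambda>p. length a + p) ` ?T) = card ?S + card ((\<lambda>p. length a + p) ` ?T)"
    by (intro card_Un_disjoint) auto
  moreover have "card ((\<lambda>p. length a + p) ` ?T) = card ?T"
    by (intro card_image) auto
  ultimately show ?thesis unfolding hamming_def by simp
qed

lemma hamming_take_le:
  assumes "length a = length b"
  shows "hamming (take m a) (take m b) \<le> hamming a b"
  using assms unfolding hamming_def by (intro card_mono) auto

section \<open>Concatenations of blocks of equal length\<close>

lemma length_concat_uniform:
  assumes "\<And>i. i < b \<Longrightarrow> length (vs i) = k"
  shows "length (concat (map vs [a..<b])) = (b - a) * k"
proof -
  have "sum_list (map (length \<circ> vs) [a..<b]) = sum_list (map (\<lambda>_. k) [a..<b])"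
    using assms by (intro arg_cong[of _ _ sum_list]) auto
  then show ?thesis by (simp add: length_concat sum_list_triv)
qed

text \<open>Compares a block sequence with itself moved by one block: this is how the distances
  between successive blocks of a concatenation ball become one Hamming distance.\<close>

lemma hamming_concat:
  assumes "\<And>i. i \<le> m \<Longrightarrow> length (vs i) = k"
  shows "hamming (concat (map vs [0..<m])) (concat (map vs [1..<m + 1]))
    = (\<Sum>i = 1..m. hamming (vs (i - 1)) (vs i))"
  using assms
proof (induction m)
  case 0
  then show ?case by (simp add: hamming_def)
next
  case (Suc m)
  have "hamming (concat (map vs [0..<m]) @ vs m) (concat (map vs [1..<m + 1]) @ vs (Suc m))
     = hamming (concat (map vs [0..<m])) (concat (map vs [1..<m + 1])) + hamming (vs m) (vs (Suc m))"
    using Suc.prems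
    by (intro hamming_append) (simp add: length_concat_uniform[where k = k] del: upt_Suc)
  then show ?case using Suc by simp
qed

text \<open>Lets blocks cut from a single function be glued again, so that block distances can be
  counted position by position.\<close>

lemma concat_map_blocks:
  "a \<le> b \<Longrightarrow> concat (map (\<lambda>i. map f [i * k..<(i + 1) * k]) [a..<b]) = map f [a * k..<b * k]"
proof (induction b)
  case (Suc b)
  show ?case
  proof (cases "a = Suc b")
    case False
    then have "a \<le> b" using Suc.prems by simp
    then have "[a * k..<Suc b * k] = [a * k..<b * k] @ [b * k..<(b + 1) * k]"
      by (metis Suc_eq_plus1 add.commute mult_Suc mult_le_mono1 upt_add_eq_append)
    then show ?thesis using Suc.IH \<open>a \<le> b\<close> by simp
  qed simp
qed simp

section \<open>Forbidden blocks\<close>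

text \<open>Cutting \<open>v @ y\<close> and \<open>y\<close> into pieces of length \<open>length v\<close> aligns \<open>vs (i - 1)\<close> with
  \<open>vs i\<close>, so the radii add up to the Hamming distance.\<close>

lemma concat_ball_iff:
  assumes "v \<noteq> []" and "length v \<le> l"
  shows "y \<in> concat_ball l r v \<longleftrightarrow> length y = l \<and> hamming (take l (v @ y)) y \<le> r"
proof -
  define k where "k = length v"
  define m where "m = nat \<lceil>real l / real k\<rceil>"
  have k: "k > 0" "k \<le> l" using assms by (auto simp: k_def)
  have "real l / real k \<le> real m" "real m < real l / real k + 1"
    using k unfolding m_def by (auto simp: ceiling_correct intro: of_nat_ceiling) linarith
  then have "real l \<le> real m * real k" "real m * real k < real l + real k"
    using k by (simp_all add: field_simps)
  then have m: "l \<le> m * k" "m * k < l + k"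
    by (metis of_nat_le_iff of_nat_mult, metis of_nat_add of_nat_less_iff of_nat_mult)
  have unfold: "concat_ball l r v =
       {take l (concat (map vs [1..<m + 1])) | (vs :: nat \<Rightarrow> bool list) (rs :: nat \<Rightarrow> nat).
          vs 0 = v \<and> (\<Sum>i = 1..m. rs i) \<le> r \<and>
          (\<forall>i\<in>{1..m}. vs i \<in> hamming_ball (rs i) (vs (i - 1)))}"
    unfolding concat_ball_def Let_def m_def k_def by simp
  show ?thesis
  proof
    assume "y \<in> concat_ball l r v"
    then obtain vs rs where y: "y = take l (concat (map vs [1..<m + 1]))"
      and vs0: "vs 0 = v" and rs: "(\<Sum>i = 1..m. rs i) \<le> r"
      and ball: "\<And>i. i \<in> {1..m} \<Longrightarrow> vs i \<in> hamming_ball (rs i) (vs (i - 1))"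
      unfolding unfold by blast
    have len: "length (vs i) = k" if "i \<le> m" for i
      using that
    proof (induction i)
      case (Suc i)
      then show ?case using ball[of "Suc i"] by (simp add: hamming_ball_def)
    qed (simp add: vs0 k_def)
    let ?V = "concat (map vs [0..<m])" and ?W = "concat (map vs [1..<m + 1])"
    have lenV: "length ?V = m * k" and lenW: "length ?W = m * k"
      using len by (subst length_concat_uniform[where k = k]; simp)+
    have "[0..<m + 1] = 0 # [1..<m + 1]" by (simp add: upt_conv_Cons)
    \<comment> \<open>Both sides list the blocks \<open>vs 0\<close> to \<open>vs m\<close>. As
      \<open>l <= m * k\<close>, the first \<open>l\<close> symbols do not reach
      \<open>vs m\<close>, so \<open>v @ ?W\<close> may be replaced by \<open>?V\<close>.\<close>
    then have "v @ ?W = concat (map vs [0..<m + 1])" using vs0 by simp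
    also have "\<dots> = ?V @ vs m" by simp
    finally have "take l (v @ ?W) = take l ?V" using lenV m by simp
    moreover have "take l (v @ y) = take l (v @ ?W)" by (simp add: y min_def)
    ultimately have "hamming (take l (v @ y)) y = hamming (take l ?V) (take l ?W)"
      by (simp add: y)
    also have "\<dots> \<le> hamming ?V ?W" using lenV lenW by (intro hamming_take_le) simp
    also have "\<dots> = (\<Sum>i = 1..m. hamming (vs (i - 1)) (vs i))"
      using len by (intro hamming_concat)
    also have "\<dots> \<le> (\<Sum>i = 1..m. rs i)"
      using ball by (intro sum_mono) (auto simp: hamming_ball_def)
    finally have "hamming (take l (v @ y)) y \<le> r" using rs by simp
    then show "length y = l \<and> hamming (take l (v @ y)) y \<le> r" using lenW m y by simp
  next
    assume asm: "length y = l \<and> hamming (take l (v @ y)) y \<le> r"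
    \<comment> \<open>\<open>f\<close> continues \<open>v @ y\<close> past its end by copying the
      symbol \<open>k\<close> places back. Hence the filler in the last block causes no mismatch:
      \<open>f p = f (k + p)\<close> for \<open>l <= p < l + k\<close>, and
      \<open>m * k < l + k\<close> means no further positions occur.\<close>
    define f where "f p = (if p < k + l then (v @ y) ! p else (v @ y) ! (p - k))" for p
    define vs where "vs i = map f [i * k..<(i + 1) * k]" for i
    define rs where "rs i = hamming (vs (i - 1)) (vs i)" for i
    have len: "length (vs i) = k" for i by (simp add: vs_def)
    have "vs 0 = v" by (auto simp: vs_def f_def k_def nth_append intro: nth_equalityI)
    have V: "concat (map vs [0..<m]) = map f [0..<m * k]"
      unfolding vs_def using concat_map_blocks[of 0 m] by simp
    have W: "concat (map vs [1..<m + 1]) = map f [k..<(m + 1) * k]"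
      unfolding vs_def using concat_map_blocks[of 1 "m + 1" f k] by (simp del: upt_Suc)
    have "(\<Sum>i = 1..m. rs i) = hamming (map f [0..<m * k]) (map f [k..<(m + 1) * k])"
      unfolding rs_def V[symmetric] W[symmetric] using len by (intro hamming_concat[symmetric])
    also have "\<dots> = card {p. p < m * k \<and> f p \<noteq> f (k + p)}"
      unfolding hamming_def by (intro arg_cong[of _ _ card]) auto
    also have "\<dots> \<le> card {p. p < l \<and> take l (v @ y) ! p \<noteq> y ! p}"
    proof (rule card_mono)
      show "{p. p < m * k \<and> f p \<noteq> f (k + p)} \<subseteq> {p. p < l \<and> take l (v @ y) ! p \<noteq> y ! p}"
      proof
        fix p assume p: "p \<in> {p. p < m * k \<and> f p \<noteq> f (k + p)}"
        then have "p < l + k" using m by simp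
        then have "p < l" using p by (auto simp: f_def split: if_splits)
        moreover have "f p = take l (v @ y) ! p" "f (k + p) = y ! p"
          using \<open>p < l\<close> by (simp_all add: f_def k_def nth_append)
        ultimately show "p \<in> {p. p < l \<and> take l (v @ y) ! p \<noteq> y ! p}" using p by simp
      qed
    qed simp
    also have "\<dots> = hamming (take l (v @ y)) y"
    proof -
      have "length (take l (v @ y)) = l" using asm by simp
      then show ?thesis unfolding hamming_def by (simp only:)
    qed
    finally have "(\<Sum>i = 1..m. rs i) \<le> r" using asm by simp
    moreover have "\<forall>i\<in>{1..m}. vs i \<in> hamming_ball (rs i) (vs (i - 1))"
      by (simp add: hamming_ball_def rs_def len)
    moreover have "y = take l (concat (map vs [1..<m + 1]))"
      unfolding W using asm m
      by (intro nth_equalityI) (auto simp: f_def k_def nth_append take_map)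
    ultimately show "y \<in> concat_ball l r v" unfolding unfold using \<open>vs 0 = v\<close> by blast
  qed
qed

text \<open>Ordinary balls belong to windows inside \<open>x\<close>; concatenation balls belong to
  windows that run on into \<open>y\<close> itself. Reading both in \<open>x @ y\<close> removes the
  distinction.\<close>

lemma forbidden_blocks_eq:
  assumes "l > 0" and "l \<le> length x"
  shows "forbidden_blocks l d x =
    (\<Union>i\<in>{1..length x}. {y. length y = l \<and> hamming (substring (x @ y) i l) y \<le> d - 1})"
proof -
  have ball: "hamming_ball (d - 1) (substring x i l) =
      {y. length y = l \<and> hamming (substring (x @ y) i l) y \<le> d - 1}"
    if "i \<in> {1..length x - l}" for i
    using that assms by (auto simp: hamming_ball_def length_substring substring_append_left)
  have cball: "concat_ball l (d - 1) (substring x i (length x - i + 1)) =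
      {y. length y = l \<and> hamming (substring (x @ y) i l) y \<le> d - 1}"
    if "i \<in> {length x - l + 1..length x}" for i
  proof -
    have "substring x i (length x - i + 1) = drop (i - 1) x"
      using that by (simp add: substring_def)
    moreover have "take l (drop (i - 1) x @ y) = substring (x @ y) i l" for y
      using that by (simp add: substring_def)
    ultimately show ?thesis using that assms by (auto simp: concat_ball_iff)
  qed
  have "{1..length x} = {1..length x - l} \<union> {length x - l + 1..length x}" using assms by auto
  then show ?thesis unfolding forbidden_blocks_def using ball cball by simp
qed

section \<open>Counting the forbidden blocks\<close>

text \<open>List the elements of such a set and pad to length \<open>r\<close> with the extra symbol
  \<open>l\<close>: the set is recovered from a word of length \<open>r\<close> over
  \<open>l + 1\<close> symbols.\<close>

lemma card_bounded_subsets_le: "card {D. D \<subseteq> {..<l} \<and> card D \<le> r} \<le> (l + 1) ^ r"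
proof -
  let ?X = "{xs. set xs \<subseteq> {..l} \<and> length xs = r}"
  have "{D. D \<subseteq> {..<l} \<and> card D \<le> r} \<subseteq> (\<lambda>xs. set xs \<inter> {..<l}) ` ?X"
  proof
    fix D assume "D \<in> {D. D \<subseteq> {..<l} \<and> card D \<le> r}"
    then have D: "D \<subseteq> {..<l}" "card D \<le> r" "finite D" by (auto intro: finite_subset)
    let ?xs = "sorted_list_of_set D @ replicate (r - card D) l"
    have "?xs \<in> ?X" "D = set ?xs \<inter> {..<l}" using D by auto
    then show "D \<in> (\<lambda>xs. set xs \<inter> {..<l}) ` ?X" by blast
  qed
  then have "card {D. D \<subseteq> {..<l} \<and> card D \<le> r} \<le> card ?X"
    by (rule surj_card_le[rotated]) (simp add: finite_lists_length_eq)
  then show ?thesis by (simp add: card_lists_length_eq)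
qed

text \<open>A string close to the window starting at \<open>i\<close>, which may overlap the string itself, is
  reconstructed from left to right from the set of positions at which the two differ.\<close>

lemma card_close_to_window_le:
  fixes x :: "bool list"
  assumes "1 \<le> i" "i \<le> length x"
  shows "card {y. length y = l \<and> hamming (substring (x @ y) i l) y \<le> r} \<le> (l + 1) ^ r"
    (is "card ?F \<le> _")
proof -
  define D where "D y = {p. p < l \<and> (x @ y) ! (i - 1 + p) \<noteq> y ! p}" for y
  have inj: "inj_on D ?F"
  proof (rule inj_onI)
    fix y z assume y: "y \<in> ?F" and z: "z \<in> ?F" and eq: "D y = D z"
    have "p < l \<longrightarrow> y ! p = z ! p" for p
    proof (induction p rule: less_induct)
      case (less p)
      show ?case
      proof
        assume "p < l"
        have "(x @ y) ! (i - 1 + p) = (x @ z) ! (i - 1 + p)"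
        proof (cases "i - 1 + p < length x")
          case False
          \<comment> \<open>The window starts inside \<open>x\<close>, so a symbol it reads from the
            new string stands strictly before \<open>p\<close> and is covered by the induction
            hypothesis.\<close>
          then have "i - 1 + p - length x < p" using assms by simp
          then show ?thesis using less.IH \<open>p < l\<close> False by (simp add: nth_append)
        qed (simp add: nth_append)
        \<comment> \<open>The alphabet is binary: the symbol read in the window, together with
          whether there is a mismatch, determines the symbol at \<open>p\<close>.\<close>
        moreover have "p \<in> D y \<longleftrightarrow> p \<in> D z" using eq by simp
        ultimately show "y ! p = z ! p" using \<open>p < l\<close> by (auto simp: D_def)
      qed
    qed
    then show "y = z" using y z by (auto intro: nth_equalityI)
  qed
  have "D y \<in> {D. D \<subseteq> {..<l} \<and> card D \<le> r}" if "y \<in> ?F" for y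
  proof -
    have "hamming (substring (x @ y) i l) (substring y 1 l) = card (D y)"
      unfolding D_def using that assms by (subst hamming_substring_nth) auto
    moreover have "substring y 1 l = y" using that by (simp add: substring_def)
    ultimately show ?thesis using that by (auto simp: D_def)
  qed
  then have "card ?F \<le> card {D. D \<subseteq> {..<l} \<and> card D \<le> r}"
    using inj by (intro card_inj_on_le) (auto intro: finite_subset[of _ "Pow {..<l}"])
  then show ?thesis using card_bounded_subsets_le[of l r] by linarith
qed

text \<open>Union bound over the window starts. There are fewer than \<open>n\<close> of them, so
  the forbidden blocks cannot exhaust all \<open>2 ^ l\<close> strings.\<close>

lemma ex_allowed_block:
  assumes "l > 0" "l \<le> length x" "length x < n" "n * (l + 1) ^ (d - 1) \<le> 2 ^ l"
  shows "\<exists>y. length y = l \<and> y \<notin> forbidden_blocks l d x"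
proof (rule ccontr)
  assume none: "\<not> ?thesis"
  let ?F = "\<lambda>i. {y :: bool list. length y = l \<and> hamming (substring (x @ y) i l) y \<le> d - 1}"
  have fin: "finite {y :: bool list. length y = l}"
    using finite_lists_length_eq[of "UNIV :: bool set" l] by simp
  have "(2::nat) ^ l = card {y :: bool list. length y = l}"
    using card_lists_length_eq[of "UNIV :: bool set" l] by simp
  also have "\<dots> \<le> card (\<Union>i\<in>{1..length x}. ?F i)"
    using none forbidden_blocks_eq[OF assms(1,2), of d]
    by (intro card_mono finite_UN_I) (auto intro: finite_subset[OF _ fin])
  also have "\<dots> \<le> (\<Sum>i = 1..length x. card (?F i))" by (rule card_UN_le) simp
  also have "\<dots> \<le> (\<Sum>i = 1..length x. (l + 1) ^ (d - 1))"
    by (intro sum_mono card_close_to_window_le) auto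
  also have "\<dots> < n * (l + 1) ^ (d - 1)" using assms(3) by simp
  finally show False using assms(4) by simp
qed

section \<open>Expansion\<close>

text \<open>The expansion invariant. The earlier windows include those overlapping the last
  block.\<close>

definition last_block_distant :: "nat \<Rightarrow> nat \<Rightarrow> bool list \<Rightarrow> bool" where
  "last_block_distant l d x \<longleftrightarrow> l \<le> length x \<and>
     (\<forall>i. 1 \<le> i \<and> i < length x - l + 1 \<longrightarrow>
        d \<le> hamming (substring x i l) (substring x (length x - l + 1) l))"

text \<open>The starts before the new block are exactly \<open>1\<close> to \<open>length x\<close>,
  the index range of the forbidden set, and exceeding \<open>d - 1\<close> means at least
  \<open>d\<close>.\<close>

lemma last_block_distant_append:
  assumes "l > 0" "l \<le> length x" "length y = l" "y \<notin> forbidden_blocks l d x"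
  shows "last_block_distant l d (x @ y)"
proof -
  have "substring (x @ y) (length x + 1) l = y" using assms by (simp add: substring_def)
  moreover have "d \<le> hamming (substring (x @ y) i l) y" if "1 \<le> i" "i \<le> length x" for i
    using assms that forbidden_blocks_eq[OF assms(1,2), of d] by fastforce
  ultimately show ?thesis using assms by (simp add: last_block_distant_def)
qed

text \<open>Every window of length \<open>2 * l\<close> that ends inside the new block covers the last \<open>l\<close> symbols
  of the old string.\<close>

lemma substring_distant_append:
  assumes sd: "substring_distant (2 * l) d x" and last: "last_block_distant l d x"
    and len: "length y = l"
  shows "substring_distant (2 * l) d (x @ y)"
  unfolding substring_distant_def
proof (intro allI impI, elim conjE)
  fix i j assume ij: "1 \<le> i" "i < j" "j \<le> length (x @ y) - 2 * l + 1"
  have l: "l \<le> length x" using last by (simp add: last_block_distant_def)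
  have j: "j - 1 + 2 * l \<le> length (x @ y)" using ij l len by simp
  show "d \<le> hamming (substring (x @ y) i (2 * l)) (substring (x @ y) j (2 * l))"
  proof (cases "j - 1 + 2 * l \<le> length x")
    case True
    then have "j \<le> length x - 2 * l + 1" using ij by simp
    then show ?thesis using sd ij True by (auto simp: substring_distant_def substring_append_left)
  next
    case False
    \<comment> \<open>The offset inside window \<open>j\<close> at which the last \<open>l\<close>
      symbols of \<open>x\<close> begin. The range of \<open>j\<close> keeps the subtraction from
      truncating, and \<open>h < l\<close> because the window ends beyond \<open>x\<close>.\<close>
    define h where "h = length x - l + 1 - j"
    have h: "j + h = length x - l + 1" "h + l \<le> 2 * l" using False ij j len l by (auto simp: h_def)
    have "d \<le> hamming (substring x (i + h) l) (substring x (j + h) l)"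
      using last ij h by (simp add: last_block_distant_def)
    also have "\<dots> = hamming (substring (x @ y) (i + h) l) (substring (x @ y) (j + h) l)"
      using ij h l by (simp add: substring_append_left)
    also have "\<dots> \<le> hamming (substring (x @ y) i (2 * l)) (substring (x @ y) j (2 * l))"
      using ij h j by (intro hamming_subwindow_le) auto
    finally show ?thesis .
  qed
qed

lemma take_in_distant_strings:
  assumes "substring_distant L d x" "n \<le> length x" "L \<le> n"
  shows "take n x \<in> distant_strings n L d"
  using assms by (auto simp: distant_strings_def substring_distant_def substring_take)

section \<open>The marker\<close>

definition marker :: "nat \<Rightarrow> nat \<Rightarrow> bool list \<Rightarrow> bool list" where
  "marker l d u = [False] @ replicate d True @ marker_end l u"

lemma length_marker_end: "length u \<le> l \<Longrightarrow> length (marker_end l u) = l"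
  by (simp add: marker_end_def)

lemma length_marker: "length u \<le> l \<Longrightarrow> length (marker l d u) = l + d + 1"
  by (simp add: marker_def length_marker_end)

text \<open>A window overlapping \<open>marker_end\<close>, shifted by \<open>a\<close>, differs from it either by auto-cyclicity
  (\<open>a \<le> d\<close>) or because the block of ones faces zeros (\<open>a > d\<close>).\<close>

lemma shifted_marker_distant:
  assumes x: "x = z @ marker l d u" and ac: "auto_cyclic d u" and u: "d \<le> length u"
    and l: "length u + d \<le> l" and a: "1 \<le> a" "a + length u \<le> l" "a < length x - l + 1"
  shows "d \<le> hamming (substring x (length x - l + 1 - a) l) (substring x (length x - l + 1) l)"
proof -
  let ?s = "length x - l"
  have lx: "length x = length z + l + d + 1" using x l by (simp add: length_marker)
  have x_end: "x ! (?s + p) = marker_end l u ! p" if "p < l" for p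
    using that lx by (simp add: x marker_def nth_append)
  have zero: "\<not> marker_end l u ! p" if "p < l - length u" for p
    using that by (simp add: marker_end_def nth_append)
  have x_u: "x ! (?s + (l - length u) + q) = u ! q" if "q < length u" for q
  proof -
    have "marker_end l u ! (l - length u + q) = u ! q" by (simp add: marker_end_def nth_append)
    moreover have "l - length u + q < l" using that l by linarith
    ultimately show ?thesis using x_end by (simp only: add.assoc)
  qed
  \<comment> \<open>The \<open>d\<close> symbols just before \<open>marker_end\<close>, read
    backwards.\<close>
  have one: "x ! (?s - Suc p)" if "p < d" for p
  proof -
    have "?s - Suc p = length z + Suc (d - Suc p)" using that lx by simp
    then have "x ! (?s - Suc p) = (replicate d True @ marker_end l u) ! (d - Suc p)"
      by (simp only: x marker_def nth_append_length_plus) simp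
    then show ?thesis using that by (simp add: nth_append)
  qed
  let ?D = "{p. p < l \<and> x ! (?s - a + p) \<noteq> x ! (?s + p)}"
  have D: "hamming (substring x (?s + 1 - a) l) (substring x (?s + 1) l) = card ?D"
    using a lx by (subst hamming_substring_nth) auto
  have "d \<le> card ?D"
  proof (cases "a \<le> d")
    case True
    \<comment> \<open>On the last \<open>length u\<close> positions the earlier window shows
      \<open>a\<close> zeros of the padding and then a prefix of \<open>u\<close>, which is the
      shifted string in the definition of auto-cyclicity.\<close>
    let ?v = "replicate a False @ take (length u - a) u"
    have "d \<le> hamming u ?v" using ac a True by (simp add: auto_cyclic_def)
    also have "\<dots> \<le> card ?D" unfolding hamming_def
    proof (rule card_inj_on_le[where f = "\<lambda>q. l - length u + q"])
      show "(\<lambda>q. l - length u + q) ` {p. p < length u \<and> u ! p \<noteq> ?v ! p} \<subseteq> ?D"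
      proof (intro image_subsetI)
        fix q assume "q \<in> {p. p < length u \<and> u ! p \<noteq> ?v ! p}"
        then have q: "q < length u" "u ! q \<noteq> ?v ! q" by auto
        have "x ! (?s - a + (l - length u + q)) = ?v ! q"
        proof (cases "q < a")
          case True
          have "?s - a + (l - length u + q) = ?s + (l - length u + q - a)"
            using a lx by simp
          moreover have "l - length u + q - a < l - length u" using True a by linarith
          ultimately show ?thesis
            using x_end[of "l - length u + q - a"] zero[of "l - length u + q - a"] True
            by (simp add: nth_append)
        next
          case False
          have "?s - a + (l - length u + q) = ?s + (l - length u) + (q - a)"
            using a lx False by simp
          then show ?thesis using False q x_u[of "q - a"] by (simp add: nth_append)
        qed
        moreover have "x ! (?s + (l - length u + q)) = u ! q"
          using x_u[OF q(1)] by (simp add: add.assoc)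
        ultimately show "l - length u + q \<in> ?D" using q l by simp
      qed
    qed auto
    finally show ?thesis .
  next
    case False
    \<comment> \<open>At these \<open>d\<close> offsets the earlier window reads the block of ones,
      while the later one is still inside the zero padding.\<close>
    have "(\<lambda>p. a - Suc p) ` {..<d} \<subseteq> ?D"
    proof (intro image_subsetI)
      fix p assume "p \<in> {..<d}"
      then have p: "p < d" by simp
      have "?s - a + (a - Suc p) = ?s - Suc p" using a p False by simp
      moreover have "a - Suc p < l - length u" using a p False by simp
      ultimately show "a - Suc p \<in> ?D"
        using one[OF p] zero[of "a - Suc p"] x_end[of "a - Suc p"] by simp
    qed
    moreover have "inj_on (\<lambda>p. a - Suc p) {..<d}" using False by (auto simp: inj_on_def)
    ultimately have "card {..<d} \<le> card ?D" by (intro card_inj_on_le) auto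
    then show ?thesis by simp
  qed
  then show ?thesis using D by simp
qed

text \<open>Starts tested by \<open>violating_index\<close> are settled by the absence of
  violations. Any later start is shifted by \<open>a\<close> with \<open>a + length u <= l\<close>,
  where the structure of the marker suffices.\<close>

lemma last_block_distant_marker:
  assumes x: "x = z @ marker l d u" and ac: "auto_cyclic d u" and u: "d \<le> length u"
    and l: "length u + d \<le> l" and nv: "\<nexists>i. violating_index l d u x i"
  shows "last_block_distant l d x"
proof -
  have lx: "length x = length z + l + d + 1" using x l by (simp add: length_marker)
  have m_end: "substring x (length x - l + 1) l = marker_end l u"
    using lx l by (simp add: x substring_def marker_def length_marker_end)
  have "d \<le> hamming (substring x i l) (substring x (length x - l + 1) l)"
    if i: "1 \<le> i" "i < length x - l + 1" for i
  proof (cases "int i \<le> int (length x) - 2 * int l + int (length u)")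
    case True
    then show ?thesis using nv i m_end by (auto simp: violating_index_def not_less)
  next
    case False
    define a where "a = length x - l + 1 - i"
    have "d \<le> hamming (substring x (length x - l + 1 - a) l) (substring x (length x - l + 1) l)"
      using i False lx l by (intro shifted_marker_distant[OF x ac u l]) (auto simp: a_def)
    moreover have "length x - l + 1 - a = i" using i by (simp add: a_def)
    ultimately show ?thesis by simp
  qed
  then show ?thesis using lx by (simp add: last_block_distant_def)
qed

lemma substring_distant_iff_no_violating_pair:
  "substring_distant L d x \<longleftrightarrow> (\<nexists>i j. violating_pair L d x i j)"
  unfolding substring_distant_def violating_pair_def by (meson not_less)

section \<open>Elimination\<close>

lemma length_index_code: "length (index_code I a) = ceil_log (card I)"
  by (simp add: index_code_def)

lemma length_enc_dist: "length (enc_dist N r v v') = r * ceil_log N"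
proof -
  have "length (enc_dist N r v v') = sum_list (map (\<lambda>i. ceil_log N) [1..<r + 1])"
    unfolding enc_dist_def length_concat map_map
    by (intro arg_cong[of _ _ sum_list] map_cong) (auto simp: length_index_code)
  then show ?thesis by (simp add: sum_list_triv)
qed

lemma remove_substring_append:
  "i - 1 + k \<le> length z \<Longrightarrow> remove_substring (z @ m) i k = remove_substring z i k @ m"
  by (simp add: remove_substring_def)

lemma length_remove_substring:
  "i - 1 + k \<le> length z \<Longrightarrow> length (remove_substring z i k) = length z - k"
  by (simp add: remove_substring_def)

text \<open>Common to all four elimination branches: the removed part lies before the marker, and
  the prepended code is shorter than what was removed.\<close>

lemma prepend_remove_substring:
  assumes "x = z @ m" "i - 1 + k \<le> length z" "length c < k"
  shows "\<exists>z'. c @ remove_substring x i k = z' @ m"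
    and "length (c @ remove_substring x i k) < length x"
  using assms by (auto simp: remove_substring_append length_remove_substring)

text \<open>\<open>A1\<close> and \<open>A2\<close> bound the code lengths of the two branches. When
  only the part before the marker is removed, \<open>i < j\<close> still leaves at least
  \<open>l - d\<close> symbols to remove, whence the summand \<open>d\<close> in
  \<open>A1\<close>.\<close>

lemma eliminate_pair_shrinks:
  assumes x: "x = z @ marker l d u" and l: "length u + d \<le> l"
    and A1: "3 + 2 * ceil_log (l + d + 2) + (d - 1) * ceil_log (2 * l) + d < l"
    and A2: "3 + 2 * ceil_log n + (d - 1) * ceil_log (2 * l) < 2 * l"
    and v: "violating_pair (2 * l) d x i j"
  shows "(\<exists>z'. eliminate_pair n (2 * l) l d x i j = z' @ marker l d u) \<and>
    length (eliminate_pair n (2 * l) l d x i j) < length x"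
proof -
  define J where "J = {int (length x) - int (2 * l) - int l - int d .. int (length x) - int (2 * l) + 1}"
  define e where "e = enc_dist (2 * l) (d - 1) (substring x i (2 * l)) (substring x j (2 * l))"
  have lx: "length x = length z + l + d + 1" using x l by (simp add: length_marker)
  have ij: "1 \<le> i" "i < j" "j \<le> length x - 2 * l + 1" using v by (auto simp: violating_pair_def)
  have J: "card J = l + d + 2" unfolding J_def by simp
  show ?thesis
  proof (cases "int i \<in> J \<and> int j \<in> J")
    case True
    let ?c = "[True, False, False] @ index_code J (int i) @ index_code J (int j) @ e"
    have eq: "eliminate_pair n (2 * l) l d x i j =
        ?c @ remove_substring x i (length x - l - d - i)"
      unfolding eliminate_pair_def Let_def using True by (simp add: J_def e_def)
    have "i - 1 + (length x - l - d - i) \<le> length z" using ij lx l by linarith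
    moreover have "length ?c < length x - l - d - i"
      using ij lx A1 by (simp add: length_index_code length_enc_dist e_def J)
    ultimately show ?thesis unfolding eq using prepend_remove_substring[OF x] by blast
  next
    case False
    let ?c = "[True, False, True] @ index_code {1..int n} (int i) @ index_code {1..int n} (int j) @ e"
    have eq: "eliminate_pair n (2 * l) l d x i j = ?c @ remove_substring x i (2 * l)"
      unfolding eliminate_pair_def Let_def using False by (simp add: J_def e_def)
    \<comment> \<open>Both indices respect the upper end of \<open>J\<close> and
      \<open>i < j\<close>, so failing the test forces \<open>i\<close> below the lower end; the
      whole window then precedes the marker.\<close>
    have "int i < int (length x) - int (2 * l) - int l - int d"
      using False ij unfolding J_def by auto
    then have "i - 1 + 2 * l \<le> length z" using lx ij by linarith
    moreover have "length ?c < 2 * l"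
      using A2 by (simp add: length_index_code length_enc_dist e_def)
    ultimately show ?thesis unfolding eq using prepend_remove_substring[OF x] by blast
  qed
qed

text \<open>As for pairs, with \<open>A3\<close> and \<open>A4\<close>. Here the part removed before
  the marker can be as short as \<open>l - d - length u\<close>.\<close>

lemma eliminate_index_shrinks:
  assumes x: "x = z @ marker l d u" and l: "length u + d \<le> l"
    and A3: "2 + ceil_log (d + length u + 1) + (d - 1) * ceil_log l + d + length u < l"
    and A4: "1 + ceil_log n + (d - 1) * ceil_log l < l"
    and v: "violating_index l d u x i"
  shows "(\<exists>z'. eliminate_index n l d u x i = z' @ marker l d u) \<and>
    length (eliminate_index n l d u x i) < length x"
proof -
  define J where "J = {int (length x) - 2 * int l - int d .. int (length x) - 2 * int l + int (length u)}"
  define e where "e = enc_dist l (d - 1) (substring x i l) (marker_end l u)"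
  have lx: "length x = length z + l + d + 1" using x l by (simp add: length_marker)
  have i: "1 \<le> i" "int i \<le> int (length x) - 2 * int l + int (length u)"
    using v by (auto simp: violating_index_def)
  have J: "card J = d + length u + 1" unfolding J_def by simp
  show ?thesis
  proof (cases "int i \<in> J")
    case True
    let ?c = "[True, True] @ index_code J (int i) @ e"
    have eq: "eliminate_index n l d u x i = ?c @ remove_substring x i (length x - l - d - i)"
      unfolding eliminate_index_def Let_def using True by (simp add: J_def e_def)
    have "i - 1 + (length x - l - d - i) \<le> length z" using i lx l by linarith
    moreover have "length ?c < length x - l - d - i"
      using i lx A3 by (simp add: length_index_code length_enc_dist e_def J)
    ultimately show ?thesis unfolding eq using prepend_remove_substring[OF x] by blast
  next
    case False
    let ?c = "[False] @ index_code {1..int n} (int i) @ e"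
    have eq: "eliminate_index n l d u x i = ?c @ remove_substring x i l"
      unfolding eliminate_index_def Let_def using False by (simp add: J_def e_def)
    have "int i < int (length x) - 2 * int l - int d" using False i unfolding J_def by auto
    then have "i - 1 + l \<le> length z" using lx i by linarith
    moreover have "length ?c < l"
      using A4 by (simp add: length_index_code length_enc_dist e_def)
    ultimately show ?thesis unfolding eq using prepend_remove_substring[OF x] by blast
  qed
qed

section \<open>Correctness for suitable parameters\<close>

fun ld_invariant :: "nat \<Rightarrow> nat \<Rightarrow> nat \<Rightarrow> bool list \<Rightarrow> ld_state \<Rightarrow> bool" where
  "ld_invariant n l d u (Eliminating x) \<longleftrightarrow> (\<exists>z. x = z @ marker l d u)"
| "ld_invariant n l d u (Expanding x) \<longleftrightarrow> substring_distant (2 * l) d x \<and> last_block_distant l d x"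
| "ld_invariant n l d u (Returned x) \<longleftrightarrow> x \<in> distant_strings n (2 * l) d"

text \<open>The offsets put every eliminating state above every expanding one, and those above
  returned states.\<close>

fun ld_rank :: "nat \<Rightarrow> ld_state \<Rightarrow> nat" where
  "ld_rank n (Eliminating x) = length x + n + 2"
| "ld_rank n (Expanding x) = n - length x + 1"
| "ld_rank n (Returned x) = 0"

text \<open>Isolates the numerical requirements: \<open>A1\<close> to \<open>A4\<close> make the
  four elimination branches shrink the string, and \<open>A5\<close> makes a new block
  available.\<close>

lemma ld_encode_returns_inI:
  assumes ac: "auto_cyclic d u" and u: "d \<le> length u"
    and n: "2 * l \<le> n"
    and A1: "3 + 2 * ceil_log (l + d + 2) + (d - 1) * ceil_log (2 * l) + d < l"
    and A2: "3 + 2 * ceil_log n + (d - 1) * ceil_log (2 * l) < 2 * l"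
    and A3: "2 + ceil_log (d + length u + 1) + (d - 1) * ceil_log l + d + length u < l"
    and A4: "1 + ceil_log n + (d - 1) * ceil_log l < l"
    and A5: "n * (l + 1) ^ (d - 1) \<le> 2 ^ l"
  shows "ld_encode_returns_in n (2 * l) l d u w (distant_strings n (2 * l) d)"
proof -
  let ?step = "ld_step n (2 * l) l d u"
  let ?inv = "ld_invariant n l d u"
  let ?start = "Eliminating (initial_string l d u w)"
  have l: "length u + d \<le> l" "l > 0" using A3 by auto
  \<comment> \<open>Proved together, since elimination is known to shrink the string only while the
    marker is in place.\<close>
  have step: "?inv s' \<and> ld_rank n s' < ld_rank n s" if "?step s s'" "?inv s" for s s'
    using that
  proof cases
    case (elim_pair x i j)
    then show ?thesis using eliminate_pair_shrinks[OF _ l(1) A1 A2] that(2) by force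
  next
    case (elim_index x i)
    then show ?thesis using eliminate_index_shrinks[OF _ l(1) A3 A4] that(2) by force
  next
    case (elim_done x)
    have "substring_distant (2 * l) d x"
      using elim_done by (simp add: substring_distant_iff_no_violating_pair)
    moreover have "last_block_distant l d x"
      using elim_done that(2) last_block_distant_marker[OF _ ac u l(1)] by auto
    ultimately show ?thesis using elim_done n by (auto simp: take_in_distant_strings)
  next
    case (expand x y)
    have inv: "substring_distant (2 * l) d x" "last_block_distant l d x"
      using expand that(2) by auto
    then have "l \<le> length x" by (simp add: last_block_distant_def)
    then show ?thesis
      using expand inv l substring_distant_append last_block_distant_append by auto
  next
    case (expand_done x)
    then show ?thesis using that(2) n by (auto simp: take_in_distant_strings)
  qed
  have start: "?inv ?start" by (simp add: initial_string_def marker_def)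
  have "\<not> (\<sigma> 0 = ?start \<and> (\<forall>t. ?step (\<sigma> t) (\<sigma> (Suc t))))" for \<sigma>
  proof
    assume \<sigma>: "\<sigma> 0 = ?start \<and> (\<forall>t. ?step (\<sigma> t) (\<sigma> (Suc t)))"
    have "?inv (\<sigma> t)" for t
    proof (induction t)
      case 0 then show ?case using \<sigma> start by simp
    next
      case (Suc t) then show ?case using \<sigma> step by blast
    qed
    then have "(\<sigma> (Suc t), \<sigma> t) \<in> measure (ld_rank n)" for t using \<sigma> step by simp
    then show False using wf_measure wf_iff_no_infinite_down_chain by blast
  qed
  moreover have "case s of Returned z \<Rightarrow> z \<in> distant_strings n (2 * l) d | _ \<Rightarrow> \<exists>s'. ?step s s'"
    if "?step\<^sup>*\<^sup>* ?start s" for s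
  proof -
    have inv: "?inv s" using that by (induction rule: rtranclp_induct) (use start step in blast)+
    show ?thesis
    proof (cases s)
      case (Eliminating x)
      have "\<exists>s'. ?step (Eliminating x) s'"
        using ld_step.elim_pair ld_step.elim_index ld_step.elim_done by metis
      then show ?thesis using Eliminating by simp
    next
      case (Expanding x)
      then have "l \<le> length x" using inv by (simp add: last_block_distant_def)
      show ?thesis
      proof (cases "length x < n")
        case True
        then have "\<exists>s'. ?step (Expanding x) s'"
          using ex_allowed_block[OF l(2) \<open>l \<le> length x\<close> True A5] ld_step.expand by metis
        then show ?thesis using Expanding by simp
      next
        case False
        then have "?step (Expanding x) (Returned (take n x))" by (simp add: ld_step.expand_done)
        then show ?thesis using Expanding by auto
      qed
    qed (use inv in simp)
  qed
  ultimately show ?thesis unfolding ld_encode_returns_in_def Let_def by blast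
qed

section \<open>Asymptotic estimates\<close>

lemma ceil_log_le: "N \<ge> 1 \<Longrightarrow> real (ceil_log N) \<le> log 2 (real N) + 1"
  unfolding ceil_log_def by (simp add: ceiling_correct)

text \<open>After division by \<open>l\<close> every summand on the left tends to zero. It serves
  the two length conditions \<open>A1\<close> and \<open>A3\<close>, whose logarithms involve
  \<open>l\<close> but not \<open>n\<close>.\<close>

lemma eventually_log_terms_less:
  fixes a b c k :: real
  assumes "a \<ge> 0" "b \<ge> 0"
  shows "\<forall>\<^sub>F l :: nat in sequentially.
    a * log 2 (real l + k) + b * log 2 (2 * real l) + c < real l"
proof -
  have "(\<lambda>l. log 2 (real l + k) / real l) \<longlonglongrightarrow> 0" by real_asymp
  moreover have "(\<lambda>l. log 2 (2 * real l) / real l) \<longlonglongrightarrow> 0" by real_asymp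
  moreover have "(\<lambda>l. 1 / real l) \<longlonglongrightarrow> 0" by real_asymp
  ultimately have "(\<lambda>l. a * (log 2 (real l + k) / real l) + b * (log 2 (2 * real l) / real l)
      + c * (1 / real l)) \<longlonglongrightarrow> a * 0 + b * 0 + c * 0"
    by (intro tendsto_intros)
  then have "\<forall>\<^sub>F l in sequentially. a * (log 2 (real l + k) / real l)
      + b * (log 2 (2 * real l) / real l) + c * (1 / real l) < 1"
    by (intro order_tendstoD(2)[where y = 0]) auto
  then show ?thesis using eventually_gt_at_top[of 0]
    by eventually_elim (simp add: field_simps)
qed

theorem theorem25:
  fixes d :: nat and \<epsilon> :: real and u :: "bool list"
  assumes "d \<ge> 1" and "\<epsilon> > 0"
    and "auto_cyclic d u" and "length u = d * ceil_log d + 2 * d"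
  shows "\<forall>\<^sub>F n :: nat in sequentially. \<forall>w :: bool list. length w = n - 1 \<longrightarrow>
    (let l = nat \<lceil>log 2 (real n) + (real d - 1 + \<epsilon>) * log 2 (log 2 (real n))\<rceil>;
         L = 2 * l
     in ld_encode_returns_in n L l d u w (distant_strings n L d))"
proof -
  define D where "D = real d - 1"
  have D: "D \<ge> 0" "real (d - 1) = D" using assms(1) by (auto simp: D_def)
  define f where "f n = log 2 (real n) + (D + \<epsilon>) * log 2 (log 2 (real n))" for n :: nat
  define l where "l n = nat \<lceil>f n\<rceil>" for n :: nat
  have De: "D + \<epsilon> > 0" using D assms by simp
  have f_top: "filterlim f at_top sequentially" unfolding f_def using De by real_asymp
  have f_le: "f n \<le> real (l n)" for n unfolding l_def by (rule of_nat_ceiling)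
  have l_top: "filterlim l at_top sequentially"
    using filterlim_at_top_mono[OF f_top] f_le
    by (metis (no_types, lifting) eventuallyI filterlim_sequentially_iff_filterlim_real)
  have "(\<lambda>n. f n / log 2 (real n)) \<longlonglongrightarrow> 1" unfolding f_def using De by real_asymp
  \<comment> \<open>Any factor strictly between 1 and 2 leaves room for the rounding in
    \<open>l n\<close>, giving \<open>l n <= 2 * log 2 n\<close>.\<close>
  then have f_small: "\<forall>\<^sub>F n in sequentially. f n / log 2 (real n) < 3 / 2"
    by (intro order_tendstoD(2)[where y = 1]) auto
  \<comment> \<open>The surplus coming from \<open>\<epsilon>\<close>: it pays for the constants in
    \<open>A2\<close> and \<open>A4\<close>. In \<open>A4\<close> the terms \<open>log 2 n\<close>
    and \<open>D * log 2 (log 2 n)\<close> are already matched exactly by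
    \<open>l n\<close>.\<close>
  have eps: "filterlim (\<lambda>n :: nat. \<epsilon> * log 2 (log 2 (real n))) at_top sequentially"
    using assms(2) by real_asymp
  \<comment> \<open>The same surplus in exponential form, absorbing the factor
    \<open>3 ^ (d - 1)\<close> in \<open>A5\<close>.\<close>
  have pw: "filterlim (\<lambda>n :: nat. log 2 (real n) powr \<epsilon>) at_top sequentially"
    using assms(2) by real_asymp
  have t_top: "filterlim (\<lambda>n :: nat. log 2 (real n)) at_top sequentially" by real_asymp
  have n4: "\<forall>\<^sub>F n :: nat in sequentially. 4 * log 2 (real n) \<le> real n" by real_asymp
  \<comment> \<open>For \<open>A1\<close>: 5 is the 3 flag bits plus the rounding of two index
    codes, and \<open>D\<close> is the rounding inside \<open>enc_dist\<close>.\<close>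
  have ev1: "\<forall>\<^sub>F n in sequentially. 2 * log 2 (real (l n) + (real d + 2))
      + D * log 2 (2 * real (l n)) + (5 + D + real d) < real (l n)"
    by (rule eventually_compose_filterlim[OF eventually_log_terms_less l_top]) (use D in auto)
  \<comment> \<open>For \<open>A3\<close>: the index code has constant length because
    \<open>u\<close> is fixed, so the first logarithm gets coefficient 0.\<close>
  have ev3: "\<forall>\<^sub>F n in sequentially. 0 * log 2 (real (l n) + 0) + D * log 2 (2 * real (l n))
      + (2 + real (ceil_log (d + length u + 1)) + D + real d + real (length u)) < real (l n)"
    by (rule eventually_compose_filterlim[OF eventually_log_terms_less l_top]) (use D in auto)
  have "\<forall>\<^sub>F n in sequentially. \<forall>w.
      ld_encode_returns_in n (2 * l n) (l n) d u w (distant_strings n (2 * l n) d)"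
    using f_small n4 ev1 ev3 filterlim_at_top_dense[THEN iffD1, OF eps, rule_format, of "5 + 3 * D"]
      filterlim_at_top_dense[THEN iffD1, OF pw, rule_format, of "3 ^ (d - 1)"]
      filterlim_at_top_dense[THEN iffD1, OF t_top, rule_format, of 2]
  proof eventually_elim
    case (elim n)
    define t where "t = log 2 (real n)"
    have t: "t > 2" using elim by (simp add: t_def)
    \<comment> \<open>For \<open>n = 0\<close> the convention \<open>ln 0 = 0\<close> would make
      \<open>t\<close> zero.\<close>
    have n: "n \<ge> 1" using t by (cases "n = 0") (auto simp: t_def log_def)
    then have n_powr: "real n = 2 powr t" by (simp add: t_def)
    have lt: "log 2 t \<ge> 0" using t by simp
    have eps_t: "\<epsilon> * log 2 t > 5 + 3 * D" using elim by (simp add: t_def)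
    have l_ge: "real (l n) \<ge> t + (D + \<epsilon>) * log 2 t" using f_le[of n] by (simp add: f_def t_def)
    have D_t: "D * log 2 t \<ge> 0" using D lt by simp
    moreover have "(D + \<epsilon>) * log 2 t = D * log 2 t + \<epsilon> * log 2 t" by (simp add: algebra_simps)
    ultimately have "real (l n) > 2" using l_ge eps_t t D by linarith
    have "f n < 3 / 2 * t" using elim t by (simp add: t_def field_simps)
    then have l_le: "real (l n) \<le> 2 * t"
      using t \<open>real (l n) > 2\<close> unfolding l_def by linarith
    have cl: "real (ceil_log (l n)) \<le> log 2 t + 2"
    proof -
      have "log 2 (real (l n)) \<le> log 2 (2 * t)" using l_le \<open>real (l n) > 2\<close> t by simp
      also have "\<dots> = 1 + log 2 t" using t by (simp add: log_mult)
      finally show ?thesis using ceil_log_le[of "l n"] \<open>real (l n) > 2\<close> by simp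
    qed
    have cl2_log: "real (ceil_log (2 * l n)) \<le> log 2 (2 * real (l n)) + 1"
      using ceil_log_le[of "2 * l n"] \<open>real (l n) > 2\<close> by simp
    have cl2: "real (ceil_log (2 * l n)) \<le> log 2 t + 3"
    proof -
      have "log 2 (2 * real (l n)) \<le> log 2 (4 * t)" using l_le \<open>real (l n) > 2\<close> t by simp
      also have "\<dots> = 2 + log 2 t" using t log_mult[of 2 4 t] log_pow_cancel[of 2 2] by simp
      finally show ?thesis using cl2_log by simp
    qed
    have cl_log: "real (ceil_log (l n)) \<le> log 2 (2 * real (l n)) + 1"
    proof -
      have "log 2 (real (l n)) \<le> log 2 (2 * real (l n))" using \<open>real (l n) > 2\<close> by simp
      moreover have "real (ceil_log (l n)) \<le> log 2 (real (l n)) + 1"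
        using \<open>real (l n) > 2\<close> by (intro ceil_log_le) simp
      ultimately show ?thesis by linarith
    qed
    have cn: "real (ceil_log n) \<le> t + 1" using ceil_log_le[of n] n by (simp add: t_def)
    show ?case
    proof (intro allI ld_encode_returns_inI assms(3))
      show "d \<le> length u" using assms(4) by simp
      show "2 * l n \<le> n" using l_le elim by (simp add: t_def)
      have "real (ceil_log (l n + d + 2)) \<le> log 2 (real (l n) + (real d + 2)) + 1"
        using ceil_log_le[of "l n + d + 2"] by (simp add: add_ac)
      moreover have "D * real (ceil_log (2 * l n)) \<le> D * (log 2 (2 * real (l n)) + 1)"
        using cl2_log D by (intro mult_left_mono)
      ultimately have "real (3 + 2 * ceil_log (l n + d + 2) + (d - 1) * ceil_log (2 * l n) + d)
          < real (l n)"
        using elim(3) unfolding of_nat_add of_nat_mult D(2) by (simp add: algebra_simps)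
      then show "3 + 2 * ceil_log (l n + d + 2) + (d - 1) * ceil_log (2 * l n) + d < l n"
        by (simp only: of_nat_less_iff)
      have "D * real (ceil_log (2 * l n)) \<le> D * (log 2 t + 3)"
        using cl2 D by (intro mult_left_mono)
      then have "real (3 + 2 * ceil_log n + (d - 1) * ceil_log (2 * l n)) < real (2 * l n)"
        using cn l_ge eps_t D_t D(1) unfolding of_nat_add of_nat_mult D(2)
        by (simp add: algebra_simps)
      then show "3 + 2 * ceil_log n + (d - 1) * ceil_log (2 * l n) < 2 * l n"
        by (simp only: of_nat_less_iff)
      have "D * real (ceil_log (l n)) \<le> D * (log 2 (2 * real (l n)) + 1)"
        using cl_log D by (intro mult_left_mono)
      then have "real (2 + ceil_log (d + length u + 1) + (d - 1) * ceil_log (l n) + d + length u)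
          < real (l n)"
        using elim(4) unfolding of_nat_add of_nat_mult D(2) by (simp add: algebra_simps)
      then show "2 + ceil_log (d + length u + 1) + (d - 1) * ceil_log (l n) + d + length u < l n"
        by (simp only: of_nat_less_iff)
      have "D * real (ceil_log (l n)) \<le> D * (log 2 t + 2)"
        using cl D by (intro mult_left_mono)
      then have "real (1 + ceil_log n + (d - 1) * ceil_log (l n)) < real (l n)"
        using cn l_ge eps_t D(1) unfolding of_nat_add of_nat_mult D(2)
        by (simp add: algebra_simps)
      then show "1 + ceil_log n + (d - 1) * ceil_log (l n) < l n"
        by (simp only: of_nat_less_iff)
      \<comment> \<open>From \<open>l n <= 2 * t\<close> and \<open>t > 2\<close>. The chain ends in
        \<open>2 powr (t + (D + \<epsilon>) * log 2 t)\<close>, whose exponent is the quantity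
        rounded up in \<open>l n\<close>.\<close>
      have "(real (l n) + 1) ^ (d - 1) \<le> (3 * t) ^ (d - 1)"
        using l_le t by (intro power_mono) auto
      also have "\<dots> = 3 ^ (d - 1) * t powr D"
        using t by (simp add: power_mult_distrib flip: D(2) powr_realpow)
      also have "\<dots> \<le> t powr \<epsilon> * t powr D"
        using elim by (intro mult_right_mono) (auto simp: t_def)
      also have "\<dots> = t powr (D + \<epsilon>)" by (simp add: powr_add)
      finally have "real n * (real (l n) + 1) ^ (d - 1) \<le> 2 powr t * t powr (D + \<epsilon>)"
        unfolding n_powr by (intro mult_left_mono) auto
      also have "t powr (D + \<epsilon>) = 2 powr ((D + \<epsilon>) * log 2 t)"
        using t by (simp add: powr_def log_def)
      also have "2 powr t * \<dots> = 2 powr (t + (D + \<epsilon>) * log 2 t)" by (simp add: powr_add)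
      also have "\<dots> \<le> 2 powr real (l n)" using l_ge by simp
      also have "\<dots> = 2 ^ l n" by (simp add: powr_realpow)
      finally have "real (n * (l n + 1) ^ (d - 1)) \<le> real (2 ^ l n)" by (simp add: add_ac)
      then show "n * (l n + 1) ^ (d - 1) \<le> 2 ^ l n" by (simp only: of_nat_le_iff)
    qed
  qed
  then show ?thesis
    by eventually_elim (simp add: l_def f_def D_def Let_def)
qed

end
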